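(* Let $1\le c\le n$. For every integer $m\ge 1$, the ideal $I_{n,c}^{(m)}\subset\Bbbk[x_1,\dots,x_n]$ is a symmetric strongly shifted ideal.
   Context: $\Bbbk$ is a field and $S=\Bbbk[x_1,\dots,x_n]$. The symmetric group $\mathfrak{S}_n$ acts on $S$ by permuting the variables; a monomial ideal $I\subset S$ is $\mathfrak{S}_n$-fixed if $\sigma(I)=I$ for all $\sigma\in\mathfrak{S}_n$. Let $\mathrm{P}_n=\{(\lambda_1,\dots,\lambda_n)\in\mathbb{Z}^n:0\le\lambda_1\le\cdots\le\lambda_n\}$, $x^\lambda=x_1^{\lambda_1}\cdots x_n^{\lambda_n}$, and $\mathrm{P}(I)=\{\lambda\in\mathrm{P}_n:x^\lambda\in I\}$. An $\mathfrak{S}_n$-fixed monomial ideal $I$ is a symmetric strongly shifted ideal if for every $\lambda\in\mathrm{P}(I)$ and all $1\le k<l\le n$ with $\lambda_k<\lambda_l$ one has $x^\lambda(x_k/x_l)\in I$. $I_{n,c}=\bigcap_{1\le i_1<\dots<i_c\le n}(x_{i_1},\dots,x_{i_c})$, and its $m$-th symbolic power is $I_{n,c}^{(m)}=\bigcap_{1\le i_1<\dots<i_c\le n}(x_{i_1},\dots,x_{i_c})^m$. *)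

theory Defs
  imports
    "HOL-Library.Poly_Mapping"
    "HOL-Combinatorics.Permutations"
    "HOL-Algebra.Ideal_Product"
begin

type_synonym expo = "nat \<Rightarrow>\<^sub>0 nat"
type_synonym 'k mpoly = "expo \<Rightarrow>\<^sub>0 'k"

definition monom :: "expo \<Rightarrow> 'k::field mpoly"
  where "monom a = Poly_Mapping.single a 1"

definition Var :: "nat \<Rightarrow> 'k::field mpoly"
  where "Var i = monom (Poly_Mapping.single i 1)"

text \<open>Exponent vectors in \<open>n\<close> variables are those supported on \<open>{1..n}\<close>, and
  \<open>poly_ring n\<close> is the ring of polynomials in the variables \<open>Var 1, \<dots>, Var n\<close>
  inside the ring of polynomials in countably many variables.\<close>

definition expos :: "nat \<Rightarrow> expo set"
  where "expos n = {a. Poly_Mapping.keys a \<subseteq> {1..n}}"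

definition poly_ring :: "nat \<Rightarrow> 'k::field mpoly ring"
  where "poly_ring n =
    \<lparr>carrier = {f. Poly_Mapping.keys f \<subseteq> expos n}, mult = (*), one = 1, zero = 0, add = (+)\<rparr>"

lemma poly_ring_cring: "cring (poly_ring n :: 'k::field mpoly ring)"
proof -
  have add: "f + g \<in> carrier (poly_ring n)"
    if "f \<in> carrier (poly_ring n)" "g \<in> carrier (poly_ring n)" for f g :: "'k mpoly"
    using that Poly_Mapping.keys_add[of f g] by (auto simp: poly_ring_def)
  have mult: "f * g \<in> carrier (poly_ring n)"
    if "f \<in> carrier (poly_ring n)" "g \<in> carrier (poly_ring n)" for f g :: "'k mpoly"
  proof -
    have "a + b \<in> expos n" if "a \<in> expos n" "b \<in> expos n" for a b
      using that Poly_Mapping.keys_add[of a b] by (auto simp: expos_def)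
    then show ?thesis
      using that Poly_Mapping.keys_mult[of f g] by (fastforce simp: poly_ring_def)
  qed
  show ?thesis
  proof (rule cringI)
    show "abelian_group (poly_ring n :: 'k mpoly ring)"
    proof (rule abelian_groupI)
      fix f :: "'k mpoly" assume "f \<in> carrier (poly_ring n)"
      then show "\<exists>g\<in>carrier (poly_ring n). g \<oplus>\<^bsub>poly_ring n\<^esub> f = \<zero>\<^bsub>poly_ring n\<^esub>"
        by (intro bexI[of _ "- f"]) (auto simp: poly_ring_def)
    qed (use add in \<open>auto simp: poly_ring_def algebra_simps\<close>)
    show "Group.comm_monoid (poly_ring n :: 'k mpoly ring)"
      by (rule comm_monoidI) (use mult in \<open>auto simp: poly_ring_def expos_def algebra_simps\<close>)
  qed (auto simp: poly_ring_def algebra_simps)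
qed

definition monomial_ideal :: "nat \<Rightarrow> 'k::field mpoly set \<Rightarrow> bool"
  where "monomial_ideal n I \<longleftrightarrow> (\<exists>A \<subseteq> expos n. I = Idl\<^bsub>poly_ring n\<^esub> (monom ` A))"

text \<open>The polynomial \<open>perm_act \<sigma> f\<close> is \<open>f(x\<^bsub>\<sigma> 1\<^esub>, \<dots>, x\<^bsub>\<sigma> n\<^esub>)\<close>.
  The factor \<open>single 0 _\<close> is a constant polynomial.\<close>

definition perm_act :: "(nat \<Rightarrow> nat) \<Rightarrow> 'k::field mpoly \<Rightarrow> 'k mpoly"
  where "perm_act \<sigma> f =
    (\<Sum>a\<in>Poly_Mapping.keys f. Poly_Mapping.single 0 (Poly_Mapping.lookup f a) *
       (\<Prod>i\<in>Poly_Mapping.keys a. Var (\<sigma> i) ^ Poly_Mapping.lookup a i))"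

definition sym_fixed :: "nat \<Rightarrow> 'k::field mpoly set \<Rightarrow> bool"
  where "sym_fixed n I \<longleftrightarrow> (\<forall>\<sigma>. \<sigma> permutes {1..n} \<longrightarrow> perm_act \<sigma> ` I = I)"

definition partitions :: "nat \<Rightarrow> expo set"
  where "partitions n = {a\<in>expos n. mono_on {1..n} (Poly_Mapping.lookup a)}"

definition ideal_partitions :: "nat \<Rightarrow> 'k::field mpoly set \<Rightarrow> expo set"
  where "ideal_partitions n I = {a\<in>partitions n. monom a \<in> I}"

text \<open>In the exchange condition, \<open>a\<^sub>l > a\<^sub>k \<ge> 0\<close>, so the pointwise truncated subtraction
  of exponents is exact and \<open>monom (a + single k 1 - single l 1)\<close> is \<open>x\<^sup>a (x\<^sub>k / x\<^sub>l)\<close>.\<close>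

definition symmetric_strongly_shifted :: "nat \<Rightarrow> 'k::field mpoly set \<Rightarrow> bool"
  where "symmetric_strongly_shifted n I \<longleftrightarrow>
    monomial_ideal n I \<and> sym_fixed n I \<and>
    (\<forall>a\<in>ideal_partitions n I. \<forall>k l. 1 \<le> k \<longrightarrow> k < l \<longrightarrow> l \<le> n \<longrightarrow>
       Poly_Mapping.lookup a k < Poly_Mapping.lookup a l \<longrightarrow>
       monom (a + Poly_Mapping.single k 1 - Poly_Mapping.single l 1) \<in> I)"

text \<open>The index sets \<open>i\<^sub>1 < \<dots> < i\<^sub>c\<close> are the \<open>c\<close>-element subsets of \<open>{1..n}\<close>.
  The power is that of the multiplicative monoid of ideals of \<open>poly_ring n\<close>.\<close>

definition star_ideal :: "nat \<Rightarrow> nat \<Rightarrow> 'k::field mpoly set"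
  where "star_ideal n c =
    (\<Inter>C\<in>{C. C \<subseteq> {1..n} \<and> card C = c}. Idl\<^bsub>poly_ring n\<^esub> (Var ` C))"

definition star_symbolic_power :: "nat \<Rightarrow> nat \<Rightarrow> nat \<Rightarrow> 'k::field mpoly set"
  where "star_symbolic_power n c m =
    (\<Inter>C\<in>{C. C \<subseteq> {1..n} \<and> card C = c}.
       (Idl\<^bsub>poly_ring n\<^esub> (Var ` C)) [^]\<^bsub>ideals_set (poly_ring n)\<^esub> m)"

lemma star_symbolic_power_1: "star_symbolic_power n c 1 = (star_ideal n c :: 'k::field mpoly set)"
proof -
  interpret S: cring "poly_ring n :: 'k mpoly ring" by (rule poly_ring_cring)
  interpret M: Group.comm_monoid "ideals_set (poly_ring n :: 'k mpoly ring)"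
    by (rule S.ideals_set_is_comm_monoid)
  have "(Idl\<^bsub>poly_ring n\<^esub> (Var ` C :: 'k mpoly set)) [^]\<^bsub>ideals_set (poly_ring n)\<^esub> (1::nat)
      = Idl\<^bsub>poly_ring n\<^esub> (Var ` C)" if "C \<subseteq> {1..n}" for C
  proof -
    have "(Var ` C :: 'k mpoly set) \<subseteq> carrier (poly_ring n)"
      using that by (auto simp: poly_ring_def Var_def monom_def expos_def)
    then have "ideal (Idl\<^bsub>poly_ring n\<^esub> (Var ` C :: 'k mpoly set)) (poly_ring n)"
      by (rule S.genideal_ideal)
    then have "Idl\<^bsub>poly_ring n\<^esub> (Var ` C :: 'k mpoly set) \<in> carrier (ideals_set (poly_ring n))"
      by (simp add: ideals_set_def)
    then show ?thesis by simp
  qed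
  then show ?thesis by (simp add: star_symbolic_power_def star_ideal_def)
qed

end

theory Submission
  imports Defs
begin

text \<open>
  Everything reduces to exponent vectors. For an \<open>n\<close>-variable exponent set \<open>A\<close> that is closed under
  adding exponents, the polynomials all of whose monomials have exponent in \<open>A\<close> form the ideal
  generated by the monomials \<open>x\<^sup>a\<close> with \<open>a \<in> A\<close>; products and intersections of such ideals are computed
  by sums and intersections of exponent sets. The ideal generated by the variables \<open>x\<^sub>i\<close>, \<open>i \<in> C\<close>,
  corresponds to the condition \<open>1 \<le> (\<Sum>i\<in>C. a\<^sub>i)\<close>, hence its \<open>m\<close>-th power to \<open>m \<le> (\<Sum>i\<in>C. a\<^sub>i)\<close>
  (\<open>variable_ideal_power\<close>), and the symbolic power to the demand that every \<open>c\<close>-element set \<open>C\<close>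
  satisfies this inequality (\<open>star_symbolic_power_eq\<close>).

  That demand is invariant under permuting the variables because permutations permute the \<open>c\<close>-element
  sets. It also survives the passage from \<open>x\<^sup>a\<close> to \<open>x\<^sup>a (x\<^sub>k / x\<^sub>l)\<close> when \<open>a\<^sub>k < a\<^sub>l\<close>
  (\<open>star_expos_exchange\<close>): the sum over \<open>C\<close> can only drop, by one, if \<open>l \<in> C\<close> and \<open>k \<notin> C\<close>; but then
  replacing \<open>l\<close> by \<open>k\<close> in \<open>C\<close> gives a \<open>c\<close>-element set whose sum for \<open>a\<close> is at least \<open>m\<close>, yet
  smaller by \<open>a\<^sub>l - a\<^sub>k \<ge> 1\<close> than the sum over \<open>C\<close>, so there is room for the drop.
\<close>

section \<open>Ideals spanned by sets of monomials\<close>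

definition monomial_span :: "expo set \<Rightarrow> 'k::field mpoly set"
  where "monomial_span A = {f. Poly_Mapping.keys f \<subseteq> A}"

definition expo_closed :: "nat \<Rightarrow> expo set \<Rightarrow> bool"
  where "expo_closed n A \<longleftrightarrow> A \<subseteq> expos n \<and> (\<forall>a\<in>A. \<forall>b\<in>expos n. a + b \<in> A)"

lemma monom_in_monomial_span [simp]:
  "(monom a :: 'k::field mpoly) \<in> monomial_span A \<longleftrightarrow> a \<in> A"
  by (simp add: monomial_span_def monom_def)

lemma monom_mult: "monom a * monom b = (monom (a + b) :: 'k::field mpoly)"
  by (simp add: monom_def mult_single)

lemma poly_ring_simps [simp]:
  "carrier (poly_ring n) = (monomial_span (expos n) :: 'k::field mpoly set)"
  "monoid.mult (poly_ring n) = ((*) :: 'k mpoly \<Rightarrow> _)"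
  "ring.add (poly_ring n) = ((+) :: 'k mpoly \<Rightarrow> _)"
  "ring.zero (poly_ring n) = (0 :: 'k mpoly)"
  "monoid.one (poly_ring n) = (1 :: 'k mpoly)"
  by (auto simp: poly_ring_def monomial_span_def)

lemma zero_in_expos [simp]: "0 \<in> expos n"
  by (simp add: expos_def)

lemma expos_add: "a \<in> expos n \<Longrightarrow> b \<in> expos n \<Longrightarrow> a + b \<in> expos n"
  using Poly_Mapping.keys_add[of a b] by (auto simp: expos_def)

lemma monomial_span_ideal:
  assumes A: "expo_closed n A"
  shows "ideal (monomial_span A :: 'k::field mpoly set) (poly_ring n)"
proof -
  interpret S: cring "poly_ring n :: 'k mpoly ring" by (rule poly_ring_cring)
  have sub: "(monomial_span A :: 'k mpoly set) \<subseteq> carrier (poly_ring n)"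
    using A by (auto simp: monomial_span_def expo_closed_def)
  have neg: "\<ominus>\<^bsub>poly_ring n\<^esub> f \<in> monomial_span A" if f: "f \<in> monomial_span A" for f :: "'k mpoly"
  proof -
    have keys: "Poly_Mapping.keys (- f) = Poly_Mapping.keys f"
      by (auto simp: in_keys_iff)
    have "\<ominus>\<^bsub>poly_ring n\<^esub> f = - f"
      by (rule S.minus_equality) (use f sub keys in \<open>auto simp: monomial_span_def\<close>)
    then show ?thesis using f keys by (simp add: monomial_span_def)
  qed
  have mult: "x * f \<in> monomial_span A"
    if "f \<in> monomial_span A" "x \<in> monomial_span (expos n)" for f x :: "'k mpoly"
    unfolding monomial_span_def
  proof safe
    fix d assume "d \<in> Poly_Mapping.keys (x * f)"
    then obtain b a where "b \<in> Poly_Mapping.keys x" "a \<in> Poly_Mapping.keys f" "d = b + a"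
      using Poly_Mapping.keys_mult[of x f] by blast
    then show "d \<in> A"
      using that A by (simp add: monomial_span_def expo_closed_def add.commute[of b] subset_iff)
  qed
  have add: "f + g \<in> monomial_span A"
    if "f \<in> monomial_span A" "g \<in> monomial_span A" for f g :: "'k mpoly"
    using that Poly_Mapping.keys_add[of f g] by (auto simp: monomial_span_def)
  have zero: "(0 :: 'k mpoly) \<in> monomial_span A"
    by (simp add: monomial_span_def)
  show ?thesis
  proof (rule idealI)
    show "subgroup (monomial_span A :: 'k mpoly set) (add_monoid (poly_ring n))"
      by (rule S.add.subgroupI) (use sub neg add zero in \<open>auto simp: a_inv_def\<close>)
  qed (use mult S.ring_axioms in \<open>auto simp: mult.commute\<close>)
qed

text \<open>A polynomial is the finite sum of its terms, and each term is a constant multiple of a monomial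
  in \<open>J\<close>.\<close>

lemma monomial_span_least:
  assumes J: "ideal (J :: 'k::field mpoly set) (poly_ring n)"
    and A: "monom ` A \<subseteq> J"
  shows "monomial_span A \<subseteq> J"
proof
  interpret J: ideal J "poly_ring n" by fact
  fix f :: "'k mpoly" assume "f \<in> monomial_span A"
  then have f: "Poly_Mapping.keys f \<subseteq> A" by (simp add: monomial_span_def)
  have const: "Poly_Mapping.single 0 r \<in> carrier (poly_ring n)" for r :: 'k
    by (auto simp: monomial_span_def)
  have monomial: "Poly_Mapping.single a (Poly_Mapping.lookup f a) \<in> J" if "a \<in> A" for a
  proof -
    have "Poly_Mapping.single 0 (Poly_Mapping.lookup f a) * monom a \<in> J"
      using J.I_l_closed[OF _ const] A that by auto
    then show ?thesis by (simp add: monom_def mult_single)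
  qed
  have "(\<Sum>a\<in>F. Poly_Mapping.single a (Poly_Mapping.lookup f a)) \<in> J"
    if "finite F" "F \<subseteq> A" for F
    using that
  proof (induction F rule: finite_induct)
    case empty
    show ?case using additive_subgroup.zero_closed[OF ideal.axioms(1)[OF J]] by simp
  next
    case (insert a F)
    then show ?case
      using additive_subgroup.a_closed[OF ideal.axioms(1)[OF J]] monomial by simp
  qed
  moreover have "f = (\<Sum>a\<in>Poly_Mapping.keys f. Poly_Mapping.single a (Poly_Mapping.lookup f a))"
    by (rule poly_mapping_eqI)
      (auto simp: lookup_sum lookup_single when_def in_keys_iff)
  ultimately show "f \<in> J" using f by (metis finite_keys)
qed

lemma genideal_monom:
  assumes A: "expo_closed n A"
  shows "Idl\<^bsub>poly_ring n\<^esub> (monom ` A) = (monomial_span A :: 'k::field mpoly set)"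
  unfolding genideal_def
  using monomial_span_ideal[OF A, where 'k = 'k] monomial_span_least[where 'k = 'k] by auto

text \<open>The first inclusion holds because the exponents occurring in \<open>f g\<close> are sums of exponents
  of \<open>f\<close> and \<open>g\<close>; the second because \<open>x\<^sup>a\<^sup>+\<^sup>b = x\<^sup>a x\<^sup>b\<close>.\<close>

lemma ideal_prod_monomial_span:
  assumes A: "expo_closed n A" and B: "expo_closed n B" and D: "expo_closed n D"
    and sum: "\<And>a b. a \<in> A \<Longrightarrow> b \<in> B \<Longrightarrow> a + b \<in> D"
    and split: "\<And>d. d \<in> D \<Longrightarrow> \<exists>a\<in>A. \<exists>b\<in>B. d = a + b"
  shows "ideal_prod (poly_ring n) (monomial_span A) (monomial_span B)
    = (monomial_span D :: 'k::field mpoly set)" (is "?P = _")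
proof
  interpret S: cring "poly_ring n :: 'k mpoly ring" by (rule poly_ring_cring)
  show "?P \<subseteq> monomial_span D"
  proof
    fix f assume "f \<in> ?P"
    then show "f \<in> monomial_span D"
    proof (induction rule: ideal_prod.induct)
      case (prod f g)
      then show ?case using Poly_Mapping.keys_mult[of f g] sum
        by (fastforce simp: monomial_span_def)
    next
      case (sum f g)
      then show ?case using Poly_Mapping.keys_add[of f g]
        by (auto simp: monomial_span_def)
    qed
  qed
  show "monomial_span D \<subseteq> ?P"
  proof (rule monomial_span_least)
    show "ideal ?P (poly_ring n)"
      using A B by (intro S.ideal_prod_is_ideal monomial_span_ideal)
    show "monom ` D \<subseteq> ?P"
    proof
      fix f :: "'k mpoly" assume "f \<in> monom ` D"
      then obtain a b where "a \<in> A" "b \<in> B" "f = monom a * monom b"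
        using split by (fastforce simp: monom_mult)
      then show "f \<in> ?P"
        using ideal_prod.prod[of "monom a" "monomial_span A" "monom b" "monomial_span B" "poly_ring n"]
        by simp
    qed
  qed
qed

section \<open>Powers of ideals generated by variables\<close>

definition threshold_expos :: "nat \<Rightarrow> nat set \<Rightarrow> nat \<Rightarrow> expo set"
  where "threshold_expos n C m = {a \<in> expos n. m \<le> (\<Sum>i\<in>C. Poly_Mapping.lookup a i)}"

lemma threshold_expos_closed: "expo_closed n (threshold_expos n C m)"
  by (auto simp: expo_closed_def threshold_expos_def expos_add lookup_add sum.distrib)

lemma sum_lookup_single:
  "finite C \<Longrightarrow> (\<Sum>j\<in>C. Poly_Mapping.lookup (Poly_Mapping.single i (e::nat)) j) = (if i \<in> C then e else 0)"
  by (auto simp: lookup_single when_def)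

text \<open>A positive sum over \<open>C\<close> has a positive entry, so one of the variables indexed by \<open>C\<close> can be
  divided out; the sum then drops by exactly one.\<close>

lemma threshold_expos_split_variable:
  assumes C: "C \<subseteq> {1..n}" and a: "a \<in> threshold_expos n C (Suc m)"
  obtains i b where "i \<in> C" "b \<in> threshold_expos n C m" "a = Poly_Mapping.single i 1 + b"
proof -
  have fin: "finite C" using C finite_subset by blast
  have "(\<Sum>i\<in>C. Poly_Mapping.lookup a i) \<noteq> 0"
    using a by (simp add: threshold_expos_def)
  then obtain i where i: "i \<in> C" "Poly_Mapping.lookup a i \<noteq> 0"
    by (meson sum.neutral)
  define b where "b = a - Poly_Mapping.single i 1"
  have ab: "a = Poly_Mapping.single i 1 + b"
    by (rule poly_mapping_eqI) (use i in \<open>auto simp: b_def lookup_add lookup_minus lookup_single when_def\<close>)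
  have "b \<in> expos n"
    using a by (auto simp: threshold_expos_def expos_def b_def in_keys_iff lookup_minus subset_iff)
  moreover have "(\<Sum>j\<in>C. Poly_Mapping.lookup a j) = 1 + (\<Sum>j\<in>C. Poly_Mapping.lookup b j)"
    using i fin by (simp add: ab lookup_add sum.distrib sum_lookup_single)
  ultimately have "b \<in> threshold_expos n C m"
    using a by (simp add: threshold_expos_def)
  then show thesis using that i ab by blast
qed

lemma single_in_threshold_expos:
  assumes "C \<subseteq> {1..n}" "i \<in> C"
  shows "Poly_Mapping.single i 1 \<in> threshold_expos n C 1"
proof -
  have "finite C" using assms finite_subset by blast
  then show ?thesis
    using assms by (auto simp: threshold_expos_def expos_def sum_lookup_single)
qed

text \<open>A monomial satisfying the threshold one is divisible by some \<open>x\<^sub>i\<close> with \<open>i \<in> C\<close>.\<close>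

lemma genideal_variables:
  assumes C: "C \<subseteq> {1..n}"
  shows "Idl\<^bsub>poly_ring n\<^esub> (Var ` C) = (monomial_span (threshold_expos n C 1) :: 'k::field mpoly set)"
proof -
  let ?T = "threshold_expos n C 1"
  have VT: "(Var ` C :: 'k mpoly set) \<subseteq> monomial_span ?T"
    using single_in_threshold_expos[OF C] by (auto simp: Var_def)
  have T: "ideal (monomial_span ?T :: 'k mpoly set) (poly_ring n)"
    by (rule monomial_span_ideal[OF threshold_expos_closed])
  have "monomial_span ?T \<subseteq> J" if J: "ideal J (poly_ring n)" "Var ` C \<subseteq> J" for J :: "'k mpoly set"
  proof (rule monomial_span_least[OF J(1)])
    show "monom ` ?T \<subseteq> J"
    proof
      fix f :: "'k mpoly" assume "f \<in> monom ` ?T"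
      then obtain a where a: "a \<in> threshold_expos n C (Suc 0)" "f = monom a" by auto
      obtain i b where "i \<in> C" "b \<in> threshold_expos n C 0" "a = Poly_Mapping.single i 1 + b"
        by (rule threshold_expos_split_variable[OF C a(1)])
      then have "f = Var i * monom b" "Var i \<in> J" "monom b \<in> carrier (poly_ring n)"
        using J(2) a(2) by (auto simp: Var_def monom_mult threshold_expos_def)
      then show "f \<in> J" using ideal.I_r_closed[OF J(1)] by simp
    qed
  qed
  then show ?thesis
    unfolding genideal_def using VT T by blast
qed

text \<open>By induction: multiplying by the ideal of the variables in \<open>C\<close> raises the threshold by exactly
  one, as a single variable can be split off each monomial of threshold \<open>m + 1\<close>.\<close>

lemma variable_ideal_power:
  assumes C: "C \<subseteq> {1..n}"
  shows "(Idl\<^bsub>poly_ring n\<^esub> (Var ` C)) [^]\<^bsub>ideals_set (poly_ring n)\<^esub> m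
    = (monomial_span (threshold_expos n C m) :: 'k::field mpoly set)"
proof (induction m)
  case 0
  show ?case by (simp add: nat_pow_def ideals_set_def threshold_expos_def)
next
  case (Suc m)
  have "ideal_prod (poly_ring n) (monomial_span (threshold_expos n C m))
      (monomial_span (threshold_expos n C 1))
    = (monomial_span (threshold_expos n C (Suc m)) :: 'k mpoly set)"
  proof (rule ideal_prod_monomial_span[OF threshold_expos_closed threshold_expos_closed threshold_expos_closed])
    fix a b assume "a \<in> threshold_expos n C m" "b \<in> threshold_expos n C 1"
    then show "a + b \<in> threshold_expos n C (Suc m)"
      by (auto simp: threshold_expos_def expos_add lookup_add sum.distrib)
  next
    fix d assume "d \<in> threshold_expos n C (Suc m)"
    then obtain i b where "i \<in> C" "b \<in> threshold_expos n C m" "d = Poly_Mapping.single i 1 + b"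
      by (rule threshold_expos_split_variable[OF C])
    then show "\<exists>a\<in>threshold_expos n C m. \<exists>b\<in>threshold_expos n C 1. d = a + b"
      using single_in_threshold_expos[OF C] by (metis add.commute)
  qed
  then show ?case
    using Suc.IH by (simp add: nat_pow_def ideals_set_def genideal_variables[OF C])
qed

section \<open>Exponents of the symbolic power\<close>

definition star_expos :: "nat \<Rightarrow> nat \<Rightarrow> nat \<Rightarrow> expo set"
  where "star_expos n c m =
    {a \<in> expos n. \<forall>C. C \<subseteq> {1..n} \<and> card C = c \<longrightarrow> m \<le> (\<Sum>i\<in>C. Poly_Mapping.lookup a i)}"

lemma star_expos_closed: "expo_closed n (star_expos n c m)"
  by (auto simp: expo_closed_def star_expos_def expos_add lookup_add sum.distrib trans_le_add1)

lemma star_symbolic_power_eq: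
  assumes "c \<le> n"
  shows "star_symbolic_power n c m = (monomial_span (star_expos n c m) :: 'k::field mpoly set)"
proof -
  \<comment> \<open>Without a \<open>c\<close>-element subset the intersection would be empty and contain polynomials in
    further variables.\<close>
  have "{1..c} \<subseteq> {1..n}" "card {1..c} = c" using assms by auto
  then have "star_expos n c m = (\<Inter>C\<in>{C. C \<subseteq> {1..n} \<and> card C = c}. threshold_expos n C m)"
    unfolding star_expos_def threshold_expos_def by blast
  moreover have "star_symbolic_power n c m
      = (\<Inter>C\<in>{C. C \<subseteq> {1..n} \<and> card C = c}. monomial_span (threshold_expos n C m) :: 'k mpoly set)"
    by (simp add: star_symbolic_power_def variable_ideal_power)
  ultimately show ?thesis
    by (auto simp: monomial_span_def)
qed

text \<open>If \<open>l \<in> C\<close> and \<open>k \<notin> C\<close>, the inequality for \<open>C\<close> after the exchange follows from the inequality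
  that \<open>a\<close> satisfies on \<open>C - {l} \<union> {k}\<close>; in all other cases the sum over \<open>C\<close> does not decrease.\<close>

lemma star_expos_exchange:
  assumes a: "a \<in> star_expos n c m" and k: "k \<in> {1..n}"
    and less: "Poly_Mapping.lookup a k < Poly_Mapping.lookup a l"
  shows "a + Poly_Mapping.single k 1 - Poly_Mapping.single l 1 \<in> star_expos n c m" (is "?b \<in> _")
proof -
  have kl: "k \<noteq> l" using less by auto
  have ba: "?b + Poly_Mapping.single l 1 = a + Poly_Mapping.single k 1"
    by (rule poly_mapping_eqI)
      (use less kl in \<open>auto simp: lookup_add lookup_minus lookup_single when_def\<close>)
  have "a + Poly_Mapping.single k 1 \<in> expos n"
    using a k by (intro expos_add) (auto simp: star_expos_def expos_def)
  then have b: "?b \<in> expos n"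
    by (fastforce simp: expos_def in_keys_iff lookup_minus subset_iff)
  have "m \<le> (\<Sum>i\<in>C. Poly_Mapping.lookup ?b i)" if C: "C \<subseteq> {1..n}" "card C = c" for C
  proof -
    have fin: "finite C" using C finite_subset by blast
    have "(\<Sum>i\<in>C. Poly_Mapping.lookup (?b + Poly_Mapping.single l 1) i)
        = (\<Sum>i\<in>C. Poly_Mapping.lookup (a + Poly_Mapping.single k 1) i)"
      by (simp only: ba)
    then have sums: "(\<Sum>i\<in>C. Poly_Mapping.lookup ?b i) + (if l \<in> C then 1 else 0)
        = (\<Sum>i\<in>C. Poly_Mapping.lookup a i) + (if k \<in> C then 1 else 0)"
      by (simp only: lookup_add[of _ "Poly_Mapping.single _ _"] sum.distrib sum_lookup_single[OF fin])
    have mC: "m \<le> (\<Sum>i\<in>C. Poly_Mapping.lookup a i)"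
      using a C by (simp add: star_expos_def)
    show ?thesis
    proof (cases "l \<in> C \<and> k \<notin> C")
      case False
      then show ?thesis using sums mC by (auto split: if_splits)
    next
      case True
      let ?C' = "insert k (C - {l})"
      have "?C' \<subseteq> {1..n}" using C k by auto
      moreover have "card ?C' = c"
        using True C fin card_Suc_Diff1[OF fin, of l] by simp
      ultimately have "m \<le> (\<Sum>i\<in>?C'. Poly_Mapping.lookup a i)"
        using a unfolding star_expos_def by blast
      also have "\<dots> = Poly_Mapping.lookup a k + (\<Sum>i\<in>C - {l}. Poly_Mapping.lookup a i)"
        using True fin by simp
      finally show ?thesis
        using sums less True sum.remove[OF fin, of l "Poly_Mapping.lookup a"] by simp
    qed
  qed
  then show ?thesis using b by (simp add: star_expos_def)
qed

section \<open>The action of permutations\<close>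

lemma Var_power: "Var i ^ e = (monom (Poly_Mapping.single i e) :: 'k::field mpoly)"
proof (induction e)
  case 0
  show ?case by (simp add: monom_def)
next
  case (Suc e)
  then show ?case by (simp add: Var_def monom_mult flip: single_add)
qed

lemma prod_monom: "(\<Prod>i\<in>F. monom (g i)) = (monom (\<Sum>i\<in>F. g i) :: 'k::field mpoly)"
proof (induction F rule: infinite_finite_induct)
  case (insert i F)
  then show ?case by (simp add: monom_mult)
qed (simp_all add: monom_def)

lemma permuted_monom:
  assumes s: "bij \<sigma>"
  shows "(\<Prod>i\<in>Poly_Mapping.keys a. Var (\<sigma> i) ^ Poly_Mapping.lookup a i)
    = (monom (Poly_Mapping.map_key (inv_into UNIV \<sigma>) a) :: 'k::field mpoly)"
proof -
  have "(\<Sum>i\<in>Poly_Mapping.keys a. Poly_Mapping.single (\<sigma> i) (Poly_Mapping.lookup a i))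
    = Poly_Mapping.map_key (inv_into UNIV \<sigma>) a"
  proof (rule poly_mapping_eqI)
    fix j
    have eq: "\<sigma> i = j \<longleftrightarrow> i = inv_into UNIV \<sigma> j" for i
      using s by (metis bij_inv_eq_iff)
    have "inj (inv_into UNIV \<sigma>)" using s by (simp add: bij_imp_bij_inv bij_is_inj)
    then show "Poly_Mapping.lookup (\<Sum>i\<in>Poly_Mapping.keys a.
          Poly_Mapping.single (\<sigma> i) (Poly_Mapping.lookup a i)) j
        = Poly_Mapping.lookup (Poly_Mapping.map_key (inv_into UNIV \<sigma>) a) j"
      by (auto simp: lookup_sum lookup_single when_def eq map_key.rep_eq in_keys_iff)
  qed
  then show ?thesis by (simp add: Var_power prod_monom)
qed

lemma map_key_inv_cancel:
  assumes "bij \<sigma>"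
  shows "Poly_Mapping.map_key (inv_into UNIV \<sigma>) (Poly_Mapping.map_key \<sigma> b) = b"
    and "Poly_Mapping.map_key \<sigma> (Poly_Mapping.map_key (inv_into UNIV \<sigma>) b) = b"
  using assms
  by (auto intro!: poly_mapping_eqI
      simp: map_key.rep_eq bij_imp_bij_inv bij_is_inj bij_is_surj surj_f_inv_f)

text \<open>The coefficient formula makes the functoriality of the action in \<open>\<sigma>\<close> visible: on
  coefficients, \<open>\<sigma>\<close> acts by reindexing exponents.\<close>

lemma lookup_perm_act:
  assumes s: "bij \<sigma>"
  shows "Poly_Mapping.lookup (perm_act \<sigma> f) b = Poly_Mapping.lookup f (Poly_Mapping.map_key \<sigma> b)"
proof -
  have eq: "Poly_Mapping.map_key (inv_into UNIV \<sigma>) a = b \<longleftrightarrow> a = Poly_Mapping.map_key \<sigma> b" for a :: expo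
    using map_key_inv_cancel[OF s] by metis
  show ?thesis
    by (auto simp: perm_act_def permuted_monom[OF s] monom_def mult_single lookup_sum
        lookup_single when_def eq in_keys_iff)
qed

text \<open>Invariance of \<open>A\<close> gives the inclusion of the image of the span in the span for every
  permutation; the inclusion for the inverse permutation then gives equality.\<close>

lemma sym_fixed_monomial_span:
  assumes A: "\<And>\<sigma> a. \<sigma> permutes {1..n} \<Longrightarrow> a \<in> A \<Longrightarrow> Poly_Mapping.map_key \<sigma> a \<in> A"
  shows "sym_fixed n (monomial_span A :: 'k::field mpoly set)"
proof -
  have sub: "perm_act \<sigma> f \<in> monomial_span A"
    if s: "\<sigma> permutes {1..n}" and f: "f \<in> monomial_span A" for \<sigma> and f :: "'k mpoly"
    unfolding monomial_span_def
  proof safe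
    fix b assume "b \<in> Poly_Mapping.keys (perm_act \<sigma> f)"
    then have "Poly_Mapping.map_key \<sigma> b \<in> A"
      using f by (auto simp: monomial_span_def in_keys_iff lookup_perm_act[OF permutes_bij[OF s]])
    then show "b \<in> A"
      using A[OF permutes_inv[OF s]] map_key_inv_cancel(1)[OF permutes_bij[OF s]] by metis
  qed
  have "f \<in> perm_act \<sigma> ` monomial_span A"
    if s: "\<sigma> permutes {1..n}" and f: "f \<in> monomial_span A" for \<sigma> and f :: "'k mpoly"
  proof
    have "bij \<sigma>" by (rule permutes_bij[OF s])
    then show "f = perm_act \<sigma> (perm_act (inv_into UNIV \<sigma>) f)"
      by (intro poly_mapping_eqI) (simp add: lookup_perm_act bij_imp_bij_inv map_key_inv_cancel)
    show "perm_act (inv_into UNIV \<sigma>) f \<in> monomial_span A"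
      by (rule sub[OF permutes_inv[OF s] f])
  qed
  then show ?thesis
    unfolding sym_fixed_def using sub by blast
qed

text \<open>The sum of the permuted exponents over \<open>C\<close> is the sum of the original ones over \<open>\<sigma> ` C\<close>, which
  is again a \<open>c\<close>-element set.\<close>

lemma star_expos_permute:
  assumes s: "\<sigma> permutes {1..n}" and a: "a \<in> star_expos n c m"
  shows "Poly_Mapping.map_key \<sigma> a \<in> star_expos n c m"
proof -
  have inj: "inj \<sigma>" by (rule permutes_inj[OF s])
  have "Poly_Mapping.map_key \<sigma> a \<in> expos n"
    using a permutes_in_image[OF s]
    by (auto simp: star_expos_def expos_def in_keys_iff map_key.rep_eq[OF inj] subset_iff)
  moreover have "m \<le> (\<Sum>i\<in>C. Poly_Mapping.lookup (Poly_Mapping.map_key \<sigma> a) i)"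
    if C: "C \<subseteq> {1..n}" "card C = c" for C
  proof -
    have injC: "inj_on \<sigma> C" using inj inj_on_subset by blast
    have "\<sigma> ` C \<subseteq> {1..n}" "card (\<sigma> ` C) = c"
      using C permutes_image[OF s] by (auto simp: card_image[OF injC])
    then have "m \<le> (\<Sum>i\<in>\<sigma> ` C. Poly_Mapping.lookup a i)"
      using a by (auto simp: star_expos_def)
    then show ?thesis
      by (simp add: sum.reindex[OF injC] map_key.rep_eq[OF inj])
  qed
  ultimately show ?thesis by (simp add: star_expos_def)
qed

section \<open>Symbolic powers are symmetric strongly shifted\<close>

theorem theorem4p3:
  fixes n c m :: nat
  assumes "1 \<le> c" and "c \<le> n" and "1 \<le> m"
  shows "symmetric_strongly_shifted n (star_symbolic_power n c m :: 'k::field mpoly set)"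
proof -
  have eq: "star_symbolic_power n c m = (monomial_span (star_expos n c m) :: 'k mpoly set)"
    by (rule star_symbolic_power_eq[OF \<open>c \<le> n\<close>])
  have "monomial_ideal n (monomial_span (star_expos n c m) :: 'k mpoly set)"
    unfolding monomial_ideal_def
    using genideal_monom[OF star_expos_closed, where 'k = 'k] star_expos_closed
    by (metis expo_closed_def)
  moreover have "sym_fixed n (monomial_span (star_expos n c m) :: 'k mpoly set)"
    by (rule sym_fixed_monomial_span[OF star_expos_permute])
  moreover have "monom (a + Poly_Mapping.single k 1 - Poly_Mapping.single l 1)
      \<in> (monomial_span (star_expos n c m) :: 'k mpoly set)"
    if "a \<in> ideal_partitions n (monomial_span (star_expos n c m) :: 'k mpoly set)"
      "1 \<le> k" "k < l" "l \<le> n" "Poly_Mapping.lookup a k < Poly_Mapping.lookup a l" for a k l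
    using that star_expos_exchange[of a n c m k l] by (simp add: ideal_partitions_def)
  ultimately show ?thesis
    unfolding symmetric_strongly_shifted_def eq by blast
qed

end
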